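(* Let $\Gamma$ be a finite connected graph on $V=\{1,\dots,n\}$ with symmetric weighted adjacency matrix $A=(a_{ij})$, let $\sigma\in[0,\infty)^n$, $U=\mathrm{diag}(\sigma_1,\dots,\sigma_n)$, and let $\lambda_n(U)$ be the largest eigenvalue of $H_U=\mathrm{Id}-D^{-1/2}(A-U)D^{-1/2}$. Write $d_i=\deg(i)$. Then \[ \max_{V_a,V_b}\left(1+\frac{1}{\mathcal{S}(\Gamma)}\Bigl(2\sum_{i\in V_a,\,j\in V_b}\frac{a_{ij}}{d_id_j}-\sum_{i,j\in V_a}\frac{a_{ij}}{d_id_j}-\sum_{i,j\in V_b}\frac{a_{ij}}{d_id_j}\Bigr)+\frac{\mathcal{S}_U(\Gamma,2)}{\mathcal{S}(\Gamma)}\right)\le\lambda_n(U), \] where the maximum is over all pairs $V_a,V_b\subset V$ with $V_a\cap V_b=\emptyset$ and $V_a\cup V_b=V$.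
   Context: $A$ has nonnegative real entries ($a_{ii}$ loop weights); $\deg(j)=\sum_i a_{ij}>0$, $D=\mathrm{diag}(\deg(1),\dots,\deg(n))$. The surface area is $\mathcal{S}(\Gamma)=\sum_{j=1}^n 1/\deg(j)$ and $\mathcal{S}_U(\Gamma,2)=\sum_{j=1}^n\sigma_j/\deg(j)^2$. In the paper the bracket is written as $2R_{-1}(\Gamma,V_a\times V_b)-R_{-1}(\Gamma,V_a)-R_{-1}(\Gamma,V_b)$ in terms of a restricted Randić index $R_{-1}(\Gamma,V_a\times V_b)$, $R_{-1}(\Gamma,\hat V)=R_{-1}(\Gamma,\hat V\times\hat V)$. *)

theory Defs
  imports
    "Jordan_Normal_Form.Spectral_Radius"
    "Graph_Theory.Pair_Digraph"
    "Graph_Theory.Digraph_Component"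
begin

text \<open>
  A weighted graph on \<open>n\<close> vertices is given by its adjacency matrix \<open>A\<close>;
  the vertex set \<open>{1, \<dots>, n}\<close> is represented by \<open>{..<n}\<close>.
\<close>

definition vertices :: "real mat \<Rightarrow> nat set" where
  "vertices A = {..<dim_row A}"

text \<open>
  The notion of connectedness used below, from the Graph Theory library, requires a nonempty
  vertex set.
\<close>

definition underlying_graph :: "real mat \<Rightarrow> nat pair_pre_digraph" where
  "underlying_graph A =
    \<lparr> pverts = vertices A,
      parcs = {(i, j). i \<in> vertices A \<and> j \<in> vertices A \<and> A $$ (i, j) \<noteq> 0} \<rparr>"

definition connected_graph :: "real mat \<Rightarrow> bool" where
  "connected_graph A \<longleftrightarrow> connected (with_proj (underlying_graph A))"

definition deg :: "real mat \<Rightarrow> nat \<Rightarrow> real" where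
  "deg A j = (\<Sum>i\<in>vertices A. A $$ (i, j))"

definition surface_area :: "real mat \<Rightarrow> real" where
  "surface_area A = (\<Sum>j\<in>vertices A. 1 / deg A j)"

definition surface_area2 :: "real mat \<Rightarrow> (nat \<Rightarrow> real) \<Rightarrow> real" where
  "surface_area2 A \<sigma> = (\<Sum>j\<in>vertices A. \<sigma> j / (deg A j)\<^sup>2)"

definition D_inv_sqrt :: "real mat \<Rightarrow> real mat" where
  "D_inv_sqrt A = mat_diag (dim_row A) (\<lambda>i. 1 / sqrt (deg A i))"

definition H_mat :: "real mat \<Rightarrow> (nat \<Rightarrow> real) \<Rightarrow> real mat" where
  "H_mat A \<sigma> = 1\<^sub>m (dim_row A)
     - D_inv_sqrt A * (A - mat_diag (dim_row A) \<sigma>) * D_inv_sqrt A"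

text \<open>
  Only applied to real symmetric matrices of positive dimension, all of whose eigenvalues are
  real, so that the maximum is taken over a finite nonempty set.
\<close>

definition largest_eigenvalue :: "real mat \<Rightarrow> real" where
  "largest_eigenvalue M = Max (spectrum M)"

end

theory Submission
  imports Defs "HOL-Analysis.Function_Topology"
begin

text \<open>
  The Rayleigh quotient of a real symmetric matrix attains its maximum \<open>\<mu>\<close> on the unit sphere, and
  a maximiser lies in the kernel of the positive semidefinite matrix \<open>\<mu> Id - M\<close>; so the Rayleigh
  quotient is bounded by the largest eigenvalue. In the coordinates \<open>y = D\<^sup>1\<^sup>/\<^sup>2 z\<close> the quadratic form
  of \<open>H\<^sub>U\<close> no longer involves square roots, and the vector \<open>z\<close> with entries \<open>1 / deg i\<close> on \<open>V\<^sub>a\<close> and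
  \<open>- 1 / deg i\<close> on \<open>V\<^sub>b\<close> turns the Rayleigh bound into the claim.
\<close>

lemma linear_coeff_eq_0_if_quadratic_nonneg:
  fixes b c :: "'a :: linordered_field"
  assumes nonneg: "\<And>t. 0 \<le> 2 * t * b + t\<^sup>2 * c"
  shows "b = 0"
proof (rule ccontr)
  assume "b \<noteq> 0"
  define m where "m = \<bar>c\<bar> + 1"
  have "m > 0" "c < 2 * m"
    unfolding m_def by auto
  have "2 * (- b / m) * b + (- b / m)\<^sup>2 * c = b\<^sup>2 * (c - 2 * m) / m\<^sup>2"
    using \<open>m > 0\<close> by (simp add: field_simps power2_eq_square)
  also have "\<dots> < 0"
    using \<open>m > 0\<close> \<open>c < 2 * m\<close> \<open>b \<noteq> 0\<close> by (simp add: divide_neg_pos mult_pos_neg)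
  finally show False
    using nonneg[of "- b / m"] by simp
qed

lemma scalar_prod_mult_mat_vec_eq_sum:
  fixes M :: "'a :: comm_semiring_0 mat"
  assumes "M \<in> carrier_mat m n" "x \<in> carrier_vec m" "y \<in> carrier_vec n"
  shows "x \<bullet> (M *\<^sub>v y) = (\<Sum>i<m. \<Sum>j<n. M $$ (i, j) * x $ i * y $ j)"
  using assms
  by (simp add: scalar_prod_def row_def atLeast0LessThan sum_distrib_left ac_simps)

lemma mat_diag_mult_vec:
  fixes f :: "nat \<Rightarrow> 'a :: semiring_0"
  assumes "v \<in> carrier_vec n"
  shows "mat_diag n f *\<^sub>v v = vec n (\<lambda>i. f i * v $ i)"
  using assms
  by (intro eq_vecI)
    (auto simp: mat_diag_def scalar_prod_def if_distrib[of "\<lambda>u. u * _"] cong: if_cong)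

lemma transpose_mat_diag: "(mat_diag n f)\<^sup>T = mat_diag n f"
  by (rule eq_matI) (auto simp: mat_diag_def)

lemma symmetric_mat_scalar_prod:
  fixes M :: "'a :: comm_semiring_0 mat"
  assumes "M \<in> carrier_mat n n" "M\<^sup>T = M" "x \<in> carrier_vec n" "y \<in> carrier_vec n"
  shows "x \<bullet> (M *\<^sub>v y) = (M *\<^sub>v x) \<bullet> y"
  using transpose_vec_mult_scalar[OF assms(1,4,3)] assms(2) by simp

lemma positive_semidefinite_mult_vec_eq_0:
  fixes M :: "real mat"
  assumes M: "M \<in> carrier_mat n n" "M\<^sup>T = M"
    and nonneg: "\<And>y. y \<in> carrier_vec n \<Longrightarrow> 0 \<le> y \<bullet> (M *\<^sub>v y)"
    and x: "x \<in> carrier_vec n" "x \<bullet> (M *\<^sub>v x) = 0"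
  shows "M *\<^sub>v x = 0\<^sub>v n"
proof -
  define r where "r = M *\<^sub>v x"
  have r: "r \<in> carrier_vec n"
    using M(1) x(1) by (simp add: r_def)
  have "0 \<le> 2 * t * (r \<bullet> r) + t\<^sup>2 * (r \<bullet> (M *\<^sub>v r))" for t
  proof -
    have "(x + t \<cdot>\<^sub>v r) \<bullet> (M *\<^sub>v (x + t \<cdot>\<^sub>v r)) = (x + t \<cdot>\<^sub>v r) \<bullet> (r + t \<cdot>\<^sub>v (M *\<^sub>v r))"
      using M(1) x(1) r by (simp add: mult_add_distrib_mat_vec[OF M(1)] mult_mat_vec[OF M(1)] r_def)
    also have "\<dots> = x \<bullet> (M *\<^sub>v x) + t * (x \<bullet> (M *\<^sub>v r)) + t * (r \<bullet> r) + t\<^sup>2 * (r \<bullet> (M *\<^sub>v r))"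
      using M(1) x(1) r
      by (simp add: add_scalar_prod_distrib[of _ n] scalar_prod_add_distrib[of _ n]
          power2_eq_square algebra_simps flip: r_def)
    also have "x \<bullet> (M *\<^sub>v r) = r \<bullet> r"
      using symmetric_mat_scalar_prod[OF M x(1) r] by (simp add: r_def)
    finally show ?thesis
      using nonneg[of "x + t \<cdot>\<^sub>v r"] x r by simp
  qed
  then have "r \<bullet> r = 0"
    by (rule linear_coeff_eq_0_if_quadratic_nonneg)
  then show ?thesis
    using conjugate_square_eq_0_vec[OF r] by (simp add: r_def)
qed

lemma compact_unit_sphere_coordinates:
  fixes I :: "'a set"
  assumes "finite I"
  shows "compact {x :: 'a \<Rightarrow> real. (\<forall>i. i \<notin> I \<longrightarrow> x i = 0) \<and> (\<Sum>i\<in>I. (x i)\<^sup>2) = 1}"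
proof -
  define box where "box = PiE UNIV (\<lambda>i. if i \<in> I then {- 1..1} else {0 :: real})"
  have "compactin (product_topology (\<lambda>i. euclidean) UNIV) box"
    unfolding box_def compactin_PiE by simp
  then have "compact box"
    by (simp add: euclidean_product_topology)
  moreover have "closed {x :: 'a \<Rightarrow> real. (\<Sum>i\<in>I. (x i)\<^sup>2) = 1}"
    by (intro closed_Collect_eq continuous_intros continuous_on_product_coordinates)
  ultimately have "compact (box \<inter> {x. (\<Sum>i\<in>I. (x i)\<^sup>2) = 1})"
    by (rule compact_Int_closed)
  moreover have "\<bar>x i\<bar> \<le> 1" if "(\<Sum>i\<in>I. (x i)\<^sup>2) = 1" "i \<in> I" for x :: "'a \<Rightarrow> real" and i
    using member_le_sum[of i I "\<lambda>i. (x i)\<^sup>2"] that assms by (simp add: abs_square_le_1)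
  then have "box \<inter> {x. (\<Sum>i\<in>I. (x i)\<^sup>2) = 1}
      = {x. (\<forall>i. i \<notin> I \<longrightarrow> x i = 0) \<and> (\<Sum>i\<in>I. (x i)\<^sup>2) = 1}"
    by (fastforce simp: box_def PiE_UNIV_domain abs_le_iff split: if_splits)
  ultimately show ?thesis by simp
qed

lemma quadratic_form_attains_max_on_unit_sphere:
  fixes M :: "real mat"
  assumes M: "M \<in> carrier_mat n n" and "n > 0"
  obtains x where "x \<in> carrier_vec n" "x \<bullet> x = 1"
    and "\<And>y. y \<in> carrier_vec n \<Longrightarrow> y \<bullet> y = 1 \<Longrightarrow> y \<bullet> (M *\<^sub>v y) \<le> x \<bullet> (M *\<^sub>v x)"
proof -
  define sphere :: "(nat \<Rightarrow> real) set"
    where "sphere = {f. (\<forall>i. i \<notin> {..<n} \<longrightarrow> f i = 0) \<and> (\<Sum>i<n. (f i)\<^sup>2) = 1}"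
  define Q where "Q f = vec n f \<bullet> (M *\<^sub>v vec n f)" for f
  have norm_vec: "vec n f \<bullet> vec n f = (\<Sum>i<n. (f i)\<^sup>2)" for f :: "nat \<Rightarrow> real"
    by (simp add: scalar_prod_def power2_eq_square atLeast0LessThan)
  have "compact sphere"
    unfolding sphere_def by (rule compact_unit_sphere_coordinates) simp
  moreover have "(\<lambda>i. if i = 0 then 1 else 0) \<in> sphere"
    using \<open>n > 0\<close> by (auto simp: sphere_def if_distrib[of "\<lambda>u. u\<^sup>2"] cong: if_cong)
  moreover have "Q = (\<lambda>f. \<Sum>i<n. \<Sum>j<n. M $$ (i, j) * f i * f j)"
    by (simp add: fun_eq_iff Q_def scalar_prod_mult_mat_vec_eq_sum[OF M])
  then have "continuous_on sphere Q"
    by (auto intro!: continuous_intros intro: continuous_on_subset[OF continuous_on_product_coordinates])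
  ultimately obtain f where f: "f \<in> sphere" and max: "\<And>g. g \<in> sphere \<Longrightarrow> Q g \<le> Q f"
    using continuous_attains_sup[of sphere Q] by auto
  show thesis
  proof (rule that[of "vec n f"])
    show "vec n f \<bullet> vec n f = 1"
      using f by (simp add: norm_vec sphere_def)
  next
    fix y :: "real vec"
    assume y: "y \<in> carrier_vec n" "y \<bullet> y = 1"
    define g where "g i = (if i < n then y $ i else 0)" for i
    have "vec n g = y"
      using y(1) by (auto simp: g_def)
    then have "g \<in> sphere"
      using y(2) norm_vec[of g] by (simp add: sphere_def g_def)
    from max[OF this] show "y \<bullet> (M *\<^sub>v y) \<le> vec n f \<bullet> (M *\<^sub>v vec n f)"
      by (simp add: Q_def \<open>vec n g = y\<close>)
  qed simp
qed

lemma Rayleigh_quotient_attains_max: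
  fixes M :: "real mat"
  assumes M: "M \<in> carrier_mat n n" and "n > 0"
  obtains x where "x \<in> carrier_vec n" "x \<bullet> x = 1"
    and "\<And>y. y \<in> carrier_vec n \<Longrightarrow> y \<bullet> (M *\<^sub>v y) \<le> (x \<bullet> (M *\<^sub>v x)) * (y \<bullet> y)"
proof (rule quadratic_form_attains_max_on_unit_sphere[OF assms])
  fix x assume x: "x \<in> carrier_vec n" "x \<bullet> x = 1"
    and max: "\<And>y. y \<in> carrier_vec n \<Longrightarrow> y \<bullet> y = 1 \<Longrightarrow> y \<bullet> (M *\<^sub>v y) \<le> x \<bullet> (M *\<^sub>v x)"
  have "y \<bullet> (M *\<^sub>v y) \<le> (x \<bullet> (M *\<^sub>v x)) * (y \<bullet> y)" if y: "y \<in> carrier_vec n" for y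
  proof (cases "y = 0\<^sub>v n")
    case True
    then show ?thesis using M by simp
  next
    case False
    define c where "c = 1 / sqrt (y \<bullet> y)"
    have "y \<bullet> y > 0"
      using conjugate_square_greater_0_vec[OF y] False by simp
    then have "c\<^sup>2 * (y \<bullet> y) = 1" "c\<^sup>2 > 0"
      by (simp_all add: c_def power_divide)
    have "(c \<cdot>\<^sub>v y) \<bullet> (c \<cdot>\<^sub>v y) = 1"
      using \<open>c\<^sup>2 * (y \<bullet> y) = 1\<close> by (simp add: power2_eq_square)
    then have "(c \<cdot>\<^sub>v y) \<bullet> (M *\<^sub>v (c \<cdot>\<^sub>v y)) \<le> x \<bullet> (M *\<^sub>v x)"
      using y by (intro max) simp_all
    also have "(c \<cdot>\<^sub>v y) \<bullet> (M *\<^sub>v (c \<cdot>\<^sub>v y)) = c\<^sup>2 * (y \<bullet> (M *\<^sub>v y))"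
      using M y by (simp add: mult_mat_vec[OF M] power2_eq_square)
    also have "x \<bullet> (M *\<^sub>v x) = c\<^sup>2 * ((x \<bullet> (M *\<^sub>v x)) * (y \<bullet> y))"
      using \<open>c\<^sup>2 * (y \<bullet> y) = 1\<close> by (simp add: algebra_simps)
    finally show ?thesis
      using \<open>c\<^sup>2 > 0\<close> by simp
  qed
  with x show thesis by (rule that)
qed

lemma Rayleigh_maximiser_eigenvector:
  fixes M :: "real mat"
  assumes M: "M \<in> carrier_mat n n" "M\<^sup>T = M"
    and x: "x \<in> carrier_vec n" "x \<bullet> x = 1"
    and max: "\<And>y. y \<in> carrier_vec n \<Longrightarrow> y \<bullet> (M *\<^sub>v y) \<le> (x \<bullet> (M *\<^sub>v x)) * (y \<bullet> y)"
  shows "eigenvector M x (x \<bullet> (M *\<^sub>v x))"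
proof -
  define \<mu> where "\<mu> = x \<bullet> (M *\<^sub>v x)"
  define N where "N = mat_diag n (\<lambda>_. \<mu>) - M"
  have N: "N \<in> carrier_mat n n" "N\<^sup>T = N"
    using M by (simp_all add: N_def minus_carrier_mat transpose_minus[of _ n n] transpose_mat_diag)
  have N_mult: "N *\<^sub>v y = \<mu> \<cdot>\<^sub>v y - M *\<^sub>v y" if "y \<in> carrier_vec n" for y
  proof -
    have "vec n (\<lambda>i. \<mu> * y $ i) = \<mu> \<cdot>\<^sub>v y"
      using that by auto
    then show ?thesis
      using that by (simp add: N_def minus_mult_distrib_mat_vec[OF _ M(1)] mat_diag_mult_vec)
  qed
  have N_form: "y \<bullet> (N *\<^sub>v y) = \<mu> * (y \<bullet> y) - y \<bullet> (M *\<^sub>v y)" if "y \<in> carrier_vec n" for y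
    using M that by (simp add: N_mult scalar_prod_minus_distrib[of _ n])
  have "N *\<^sub>v x = 0\<^sub>v n"
    by (rule positive_semidefinite_mult_vec_eq_0[OF N])
      (use x max in \<open>simp_all add: N_form \<mu>_def\<close>)
  then have "(\<mu> \<cdot>\<^sub>v x - M *\<^sub>v x) $ i = 0" if "i < n" for i
    using that by (simp add: N_mult[OF x(1), symmetric])
  then have "M *\<^sub>v x = \<mu> \<cdot>\<^sub>v x"
    using M x(1) by (intro eq_vecI) auto
  moreover have "x \<noteq> 0\<^sub>v n"
    using x(2) by auto
  ultimately show ?thesis
    using M(1) x(1) by (simp add: eigenvector_def \<mu>_def)
qed

lemma quadratic_form_le_Max_spectrum:
  fixes M :: "real mat"
  assumes M: "M \<in> carrier_mat n n" "M\<^sup>T = M" and y: "y \<in> carrier_vec n"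
  shows "y \<bullet> (M *\<^sub>v y) \<le> Max (spectrum M) * (y \<bullet> y)"
proof (cases "n = 0")
  case True
  then show ?thesis using M y by (simp add: scalar_prod_def)
next
  case False
  then obtain x where x: "x \<in> carrier_vec n" "x \<bullet> x = 1"
    and max: "\<And>y. y \<in> carrier_vec n \<Longrightarrow> y \<bullet> (M *\<^sub>v y) \<le> (x \<bullet> (M *\<^sub>v x)) * (y \<bullet> y)"
    using Rayleigh_quotient_attains_max[OF M(1)] by blast
  have "x \<bullet> (M *\<^sub>v x) \<in> spectrum M"
    using Rayleigh_maximiser_eigenvector[OF M x max] by (auto simp: spectrum_def eigenvalue_def)
  then have "x \<bullet> (M *\<^sub>v x) \<le> Max (spectrum M)"
    using card_finite_spectrum(1)[OF M(1)] by simp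
  then have "(x \<bullet> (M *\<^sub>v x)) * (y \<bullet> y) \<le> Max (spectrum M) * (y \<bullet> y)"
    using conjugate_square_ge_0_vec[of y] by (simp add: mult_right_mono)
  with max[OF y] show ?thesis by linarith
qed

lemma D_inv_sqrt_carrier:
  assumes "A \<in> carrier_mat n n"
  shows "D_inv_sqrt A \<in> carrier_mat n n"
  using assms by (simp add: D_inv_sqrt_def)

lemma D_inv_sqrt_symmetric: "(D_inv_sqrt A)\<^sup>T = D_inv_sqrt A"
  by (simp add: D_inv_sqrt_def transpose_mat_diag)

lemma D_inv_sqrt_mult_vec_sqrt_deg:
  assumes "A \<in> carrier_mat n n" and "\<And>i. i < n \<Longrightarrow> 0 < deg A i"
  shows "D_inv_sqrt A *\<^sub>v vec n (\<lambda>i. sqrt (deg A i) * z i) = vec n z"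
  using assms(1)
  by (intro eq_vecI) (auto simp: D_inv_sqrt_def mat_diag_mult_vec dest: assms(2))

lemma H_mat_carrier:
  assumes "A \<in> carrier_mat n n"
  shows "H_mat A \<sigma> \<in> carrier_mat n n"
  using assms D_inv_sqrt_carrier[OF assms] unfolding H_mat_def
  by (auto intro!: minus_carrier_mat mult_carrier_mat)

lemma H_mat_symmetric:
  assumes A: "A \<in> carrier_mat n n" "A\<^sup>T = A"
  shows "(H_mat A \<sigma>)\<^sup>T = H_mat A \<sigma>"
proof -
  let ?B = "D_inv_sqrt A" and ?C = "A - mat_diag n \<sigma>"
  note B = D_inv_sqrt_carrier[OF A(1)] D_inv_sqrt_symmetric
  have C: "?C \<in> carrier_mat n n" "?C\<^sup>T = ?C"
    using A by (simp_all add: minus_carrier_mat transpose_minus[of _ n n] transpose_mat_diag)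
  have "(?B * ?C * ?B)\<^sup>T = ?B * ?C * ?B"
    using B C by (simp add: transpose_mult[of _ n n _ n])
  moreover have "H_mat A \<sigma> = 1\<^sub>m n - ?B * ?C * ?B"
    using A(1) by (simp add: H_mat_def)
  ultimately show ?thesis
    using B(1) C(1) by (simp add: transpose_minus[of _ n n])
qed

lemma quadratic_form_H_mat:
  fixes z :: "nat \<Rightarrow> real"
  assumes A: "A \<in> carrier_mat n n" and deg: "\<And>i. i < n \<Longrightarrow> 0 < deg A i"
  defines "y \<equiv> vec n (\<lambda>i. sqrt (deg A i) * z i)"
  shows "y \<bullet> (H_mat A \<sigma> *\<^sub>v y)
    = y \<bullet> y + (\<Sum>i<n. \<sigma> i * (z i)\<^sup>2) - (\<Sum>i<n. \<Sum>j<n. A $$ (i, j) * z i * z j)"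
proof -
  define B where "B = D_inv_sqrt A"
  define U where "U = mat_diag n \<sigma>"
  define w where "w = vec n z"
  have carrier: "B \<in> carrier_mat n n" "U \<in> carrier_mat n n" "w \<in> carrier_vec n" "y \<in> carrier_vec n"
    using D_inv_sqrt_carrier[OF A] by (simp_all add: B_def U_def w_def y_def)
  have AU: "A - U \<in> carrier_mat n n"
    using carrier(2) by (rule minus_carrier_mat)
  have B_y: "B *\<^sub>v y = w"
    unfolding B_def y_def w_def using A deg by (rule D_inv_sqrt_mult_vec_sqrt_deg)
  have "H_mat A \<sigma> = 1\<^sub>m n - B * (A - U) * B"
    using A by (simp add: H_mat_def B_def U_def)
  also have "\<dots> *\<^sub>v y = y - B *\<^sub>v ((A - U) *\<^sub>v w)"
    using carrier AU
    by (simp add: minus_mult_distrib_mat_vec[of _ n n] assoc_mult_mat_vec[of _ n n _ n]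
        mult_carrier_mat[of _ n n] flip: B_y)
  finally have "y \<bullet> (H_mat A \<sigma> *\<^sub>v y) = y \<bullet> y - y \<bullet> (B *\<^sub>v ((A - U) *\<^sub>v w))"
    using carrier AU by (simp add: scalar_prod_minus_distrib[of _ n])
  also have "y \<bullet> (B *\<^sub>v ((A - U) *\<^sub>v w)) = w \<bullet> ((A - U) *\<^sub>v w)"
    using symmetric_mat_scalar_prod[of B n y "(A - U) *\<^sub>v w"] carrier AU B_y
    by (simp add: B_def D_inv_sqrt_symmetric)
  also have "\<dots> = w \<bullet> (A *\<^sub>v w) - w \<bullet> (U *\<^sub>v w)"
    using A carrier
    by (simp add: minus_mult_distrib_mat_vec[of _ n n] scalar_prod_minus_distrib[of _ n])
  also have "w \<bullet> (A *\<^sub>v w) = (\<Sum>i<n. \<Sum>j<n. A $$ (i, j) * z i * z j)"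
    using scalar_prod_mult_mat_vec_eq_sum[OF A carrier(3,3)] by (simp add: w_def)
  also have "w \<bullet> (U *\<^sub>v w) = (\<Sum>i<n. \<sigma> i * (z i)\<^sup>2)"
    by (simp add: U_def w_def mat_diag_mult_vec scalar_prod_def power2_eq_square
        atLeast0LessThan ac_simps)
  finally show ?thesis by simp
qed

lemma weighted_form_le_largest_eigenvalue_H_mat:
  fixes z :: "nat \<Rightarrow> real"
  assumes A: "A \<in> carrier_mat n n" "A\<^sup>T = A" and deg: "\<And>i. i < n \<Longrightarrow> 0 < deg A i"
  shows "(\<Sum>i<n. deg A i * (z i)\<^sup>2) + (\<Sum>i<n. \<sigma> i * (z i)\<^sup>2)
      - (\<Sum>i<n. \<Sum>j<n. A $$ (i, j) * z i * z j)
    \<le> largest_eigenvalue (H_mat A \<sigma>) * (\<Sum>i<n. deg A i * (z i)\<^sup>2)"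
proof -
  define y where "y = vec n (\<lambda>i. sqrt (deg A i) * z i)"
  have "y \<bullet> y = (\<Sum>i<n. (sqrt (deg A i) * z i)\<^sup>2)"
    by (simp add: y_def scalar_prod_def power2_eq_square atLeast0LessThan)
  also have "\<dots> = (\<Sum>i<n. deg A i * (z i)\<^sup>2)"
    by (intro sum.cong) (auto simp: power_mult_distrib less_imp_le deg)
  finally have norm_y: "y \<bullet> y = (\<Sum>i<n. deg A i * (z i)\<^sup>2)" .
  have "y \<bullet> (H_mat A \<sigma> *\<^sub>v y) \<le> largest_eigenvalue (H_mat A \<sigma>) * (y \<bullet> y)"
    unfolding largest_eigenvalue_def y_def
    by (rule quadratic_form_le_Max_spectrum[OF H_mat_carrier[OF A(1)] H_mat_symmetric[OF A]]) simp
  then show ?thesis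
    using quadratic_form_H_mat[OF A(1) deg, of z \<sigma>] norm_y by (simp add: y_def)
qed

lemma sum_signs_on_partition:
  fixes f :: "'a \<Rightarrow> 'a \<Rightarrow> 'b :: comm_ring_1"
  assumes "finite P" "finite Q" "P \<inter> Q = {}"
    and sym: "\<And>i j. i \<in> P \<Longrightarrow> j \<in> Q \<Longrightarrow> f j i = f i j"
    and s: "\<And>i. i \<in> P \<Longrightarrow> s i = 1" "\<And>i. i \<in> Q \<Longrightarrow> s i = - 1"
  shows "(\<Sum>i\<in>P \<union> Q. \<Sum>j\<in>P \<union> Q. f i j * s i * s j)
    = (\<Sum>i\<in>P. \<Sum>j\<in>P. f i j) + (\<Sum>i\<in>Q. \<Sum>j\<in>Q. f i j) - 2 * (\<Sum>i\<in>P. \<Sum>j\<in>Q. f i j)"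
proof -
  have "(\<Sum>i\<in>Q. \<Sum>j\<in>P. f i j) = (\<Sum>i\<in>P. \<Sum>j\<in>Q. f i j)"
    by (subst sum.swap) (simp add: sym)
  then show ?thesis
    by (simp add: sum.union_disjoint[OF assms(1-3)] s sum_subtractf sum_negf)
qed

text \<open>\<open>R\<^sub>-\<^sub>1(\<Gamma>, P \<times> Q)\<close> in the paper.\<close>

definition restricted_Randic_index :: "real mat \<Rightarrow> nat set \<Rightarrow> nat set \<Rightarrow> real" where
  "restricted_Randic_index A P Q = (\<Sum>i\<in>P. \<Sum>j\<in>Q. A $$ (i, j) / (deg A i * deg A j))"

lemma signed_form_eq_restricted_Randic_index:
  assumes A: "A \<in> carrier_mat n n" "A\<^sup>T = A"
    and partition: "P \<inter> Q = {}" "P \<union> Q = {..<n}"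
    and s: "\<And>i. i \<in> P \<Longrightarrow> s i = 1" "\<And>i. i \<in> Q \<Longrightarrow> s i = - 1"
  shows "(\<Sum>i<n. \<Sum>j<n. A $$ (i, j) * (s i / deg A i) * (s j / deg A j))
    = restricted_Randic_index A P P + restricted_Randic_index A Q Q
      - 2 * restricted_Randic_index A P Q"
proof -
  define f where "f i j = A $$ (i, j) / (deg A i * deg A j)" for i j
  have "finite P" "finite Q"
    using partition(2) by (metis finite_Un finite_lessThan)+
  moreover have "f j i = f i j" if "i \<in> P" "j \<in> Q" for i j
  proof -
    have "i < n" "j < n"
      using that partition(2) by auto
    then have "A\<^sup>T $$ (j, i) = A $$ (i, j)"
      using A(1) by simp
    then show ?thesis by (simp add: f_def A(2) mult.commute)
  qed
  ultimately have "(\<Sum>i<n. \<Sum>j<n. f i j * s i * s j)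
      = (\<Sum>i\<in>P. \<Sum>j\<in>P. f i j) + (\<Sum>i\<in>Q. \<Sum>j\<in>Q. f i j) - 2 * (\<Sum>i\<in>P. \<Sum>j\<in>Q. f i j)"
    using sum_signs_on_partition[of P Q f s] partition s by simp
  then show ?thesis
    by (simp add: f_def restricted_Randic_index_def)
qed

lemma partition_bound_le_largest_eigenvalue_H_mat:
  assumes A: "A \<in> carrier_mat n n" "A\<^sup>T = A" and "n > 0"
    and deg: "\<And>i. i < n \<Longrightarrow> 0 < deg A i"
    and partition: "P \<inter> Q = {}" "P \<union> Q = {..<n}"
  shows "1 + 1 / surface_area A * (2 * restricted_Randic_index A P Q
        - restricted_Randic_index A P P - restricted_Randic_index A Q Q)
      + surface_area2 A \<sigma> / surface_area A
    \<le> largest_eigenvalue (H_mat A \<sigma>)"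
    (is "1 + 1 / ?S * ?R + ?S\<^sub>2 / ?S \<le> ?\<mu>")
proof -
  define s :: "nat \<Rightarrow> real" where "s i = (if i \<in> P then 1 else - 1)" for i
  define z where "z i = s i / deg A i" for i
  have S: "?S = (\<Sum>i<n. 1 / deg A i)" and S\<^sub>2: "?S\<^sub>2 = (\<Sum>i<n. \<sigma> i / (deg A i)\<^sup>2)"
    using A(1) by (simp_all add: surface_area_def surface_area2_def vertices_def)
  have "?S > 0"
    unfolding S using deg \<open>n > 0\<close> by (intro sum_pos) auto
  have "deg A i * (z i)\<^sup>2 = 1 / deg A i" "\<sigma> i * (z i)\<^sup>2 = \<sigma> i / (deg A i)\<^sup>2" for i
    by (simp_all add: z_def s_def power2_eq_square)
  moreover have "(\<Sum>i<n. \<Sum>j<n. A $$ (i, j) * z i * z j) = - ?R"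
  proof -
    have "s i = 1" if "i \<in> P" for i
      using that by (simp add: s_def)
    moreover have "s i = - 1" if "i \<in> Q" for i
      using that partition(1) by (auto simp: s_def)
    ultimately show ?thesis
      using signed_form_eq_restricted_Randic_index[OF A partition, of s] by (simp add: z_def)
  qed
  ultimately have "?S + ?S\<^sub>2 + ?R \<le> ?\<mu> * ?S"
    using weighted_form_le_largest_eigenvalue_H_mat[OF A deg, of z \<sigma>] by (simp add: S S\<^sub>2)
  then have "(?S + ?S\<^sub>2 + ?R) / ?S \<le> ?\<mu>"
    using \<open>?S > 0\<close> by (simp add: pos_divide_le_eq)
  then show ?thesis
    using \<open>?S > 0\<close> by (simp add: add_divide_distrib)
qed

lemma connected_graph_dim_pos:
  assumes "connected_graph A"
  shows "0 < dim_row A"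
proof -
  have "pverts (underlying_graph A) \<noteq> {}"
    using assms unfolding connected_graph_def connected_def strongly_connected_def by auto
  then show ?thesis
    by (auto simp: underlying_graph_def vertices_def)
qed

theorem mainTheorem8:
  fixes n :: nat and A :: "real mat" and \<sigma> :: "nat \<Rightarrow> real"
  assumes "A \<in> carrier_mat n n"
    and "\<And>i j. i < n \<Longrightarrow> j < n \<Longrightarrow> 0 \<le> A $$ (i, j)"
    and "\<And>i j. i < n \<Longrightarrow> j < n \<Longrightarrow> A $$ (i, j) = A $$ (j, i)"
    and "connected_graph A"
    and "\<And>j. j < n \<Longrightarrow> 0 < deg A j"
    and "\<And>j. j < n \<Longrightarrow> 0 \<le> \<sigma> j"
  shows "(MAX (V\<^sub>a, V\<^sub>b) \<in> {(V\<^sub>a, V\<^sub>b). V\<^sub>a \<subseteq> vertices A \<and> V\<^sub>b \<subseteq> vertices A \<and>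
              V\<^sub>a \<inter> V\<^sub>b = {} \<and> V\<^sub>a \<union> V\<^sub>b = vertices A}.
            1 + 1 / surface_area A *
                  (2 * (\<Sum>i\<in>V\<^sub>a. \<Sum>j\<in>V\<^sub>b. A $$ (i, j) / (deg A i * deg A j))
                     - (\<Sum>i\<in>V\<^sub>a. \<Sum>j\<in>V\<^sub>a. A $$ (i, j) / (deg A i * deg A j))
                     - (\<Sum>i\<in>V\<^sub>b. \<Sum>j\<in>V\<^sub>b. A $$ (i, j) / (deg A i * deg A j)))
              + surface_area2 A \<sigma> / surface_area A)
         \<le> largest_eigenvalue (H_mat A \<sigma>)"
proof -
  have V: "vertices A = {..<n}" and "n > 0"
    using assms(1) connected_graph_dim_pos[OF assms(4)] by (auto simp: vertices_def)
  have "A\<^sup>T = A"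
    using assms(1,3) by (intro eq_matI) auto
  let ?partitions = "{(V\<^sub>a, V\<^sub>b). V\<^sub>a \<subseteq> vertices A \<and> V\<^sub>b \<subseteq> vertices A \<and>
              V\<^sub>a \<inter> V\<^sub>b = {} \<and> V\<^sub>a \<union> V\<^sub>b = vertices A}"
  have "?partitions \<subseteq> Pow (vertices A) \<times> Pow (vertices A)" by auto
  then have "finite ?partitions"
    by (rule finite_subset) (simp add: V)
  moreover have "({}, vertices A) \<in> ?partitions" by simp
  ultimately show ?thesis
    using partition_bound_le_largest_eigenvalue_H_mat
      [OF assms(1) \<open>A\<^sup>T = A\<close> \<open>n > 0\<close> assms(5), unfolded restricted_Randic_index_def]
    by (subst Max_le_iff) (auto simp: V)
qed

end
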